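(* Let $k\ge 2$ be an integer and let $n_1,n_2$ be positive integers which do not divide $k$ and such that $n_1+n_2$ is a proper divisor of $k$. Then $n_1\mathcal{P}_{k,k+2}$ and $n_2\mathcal{P}_{k,k+2}$ are normal, while $(n_1+n_2)\mathcal{P}_{k,k+2}$ is not normal. In particular, $2\mathcal{P}_{25,27}$ and $3\mathcal{P}_{25,27}$ are normal, while $5\mathcal{P}_{25,27}$ is not normal.
   Context: Let $k\ge2$ and $a\ge0$ be integers. Let $C_{2k}$ be the cycle with vertices $1,\dots,2k$ in cyclic order and edges $(i,i+1)$, $i=1,\dots,2k$, where $(2k,2k+1)$ means $(2k,1)$. For an edge $e$ let $V(e)\in\mathbb{Z}^{2k}$ be the vector with coordinates $V(e)_v=1$ if $v\in e$ and $V(e)_v=0$ otherwise. The polytope $\mathcal{P}_{k,a}$ is the convex hull in $\mathbb{Z}^{2k}\times\mathbb{Z}$ (tensored with the reals) of the points $(V(i,i+1),0)$, $(V(i,i+1),1)$ for $i=2,3,\dots,2k$, together with $(V(1,2),a)$ and $(V(1,2),a+1)$. A lattice polytope $\mathcal{P}$ is normal in a lattice $M$ (here $M=\mathbb{Z}^{2k}\times\mathbb{Z}$) if for every positive integer $m$ every lattice point in $m\mathcal{P}$ is a sum of $m$ lattice points of $\mathcal{P}$. A proper divisor of $k$ is a positive divisor smaller than $k$. *)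

theory Defs
  imports "HOL-Analysis.Analysis" "HOL-Analysis.Finite_Function_Topology"
begin

text \<open>
  The real space containing the polytope for a given \<open>k\<close> is the set of all pairs \<open>(x, h)\<close> whose
  first component \<open>x\<close>, a finitely supported function on the naturals, has support in \<open>{1..2 * k}\<close>.
  Since the dimension depends on \<open>k\<close>, all these spaces are placed in the single real vector space
  \<open>(nat \<Rightarrow>\<^sub>0 real) \<times> real\<close>; the lattice below is confined to the coordinates \<open>1, \<dots>, 2 * k\<close>.
\<close>

definition cycle_lattice :: "nat \<Rightarrow> ((nat \<Rightarrow>\<^sub>0 real) \<times> real) set" where
  "cycle_lattice k =
     {x. Poly_Mapping.keys (fst x) \<subseteq> {1..2 * k} \<and>
         (\<forall>v. Poly_Mapping.lookup (fst x) v \<in> \<int>) \<and> snd x \<in> \<int>}"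

definition cycle_edge :: "nat \<Rightarrow> nat \<Rightarrow> nat set" where
  "cycle_edge k i = {i, if i = 2 * k then 1 else i + 1}"

definition edge_vec :: "nat set \<Rightarrow> (nat \<Rightarrow>\<^sub>0 real)" where
  "edge_vec e = (\<Sum>v\<in>e. Poly_Mapping.single v 1)"

lemma lookup_edge_vec:
  assumes "finite e"
  shows "Poly_Mapping.lookup (edge_vec e) v = (if v \<in> e then 1 else 0)"
  using assms by (simp add: edge_vec_def lookup_sum lookup_single when_def)

definition cycle_polytope_vertices :: "nat \<Rightarrow> nat \<Rightarrow> ((nat \<Rightarrow>\<^sub>0 real) \<times> real) set" where
  "cycle_polytope_vertices k a =
     (\<Union>i\<in>{2..2 * k}. {(edge_vec (cycle_edge k i), 0), (edge_vec (cycle_edge k i), 1)}) \<union>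
     {(edge_vec (cycle_edge k 1), real a), (edge_vec (cycle_edge k 1), real a + 1)}"

definition cycle_polytope :: "nat \<Rightarrow> nat \<Rightarrow> ((nat \<Rightarrow>\<^sub>0 real) \<times> real) set" where
  "cycle_polytope k a = convex hull (cycle_polytope_vertices k a)"

definition dilate :: "nat \<Rightarrow> 'a::real_vector set \<Rightarrow> 'a set" where
  "dilate n P = (\<lambda>x. real n *\<^sub>R x) ` P"

definition lattice_polytope :: "'a::real_vector set \<Rightarrow> 'a set \<Rightarrow> bool" where
  "lattice_polytope M P \<longleftrightarrow> (\<exists>V. finite V \<and> V \<subseteq> M \<and> P = convex hull V)"

text \<open>
  Normality of a lattice polytope \<open>P\<close> in the lattice \<open>M\<close>. That \<open>P\<close> is a lattice polytope is not
  part of the predicate, so that its negation says precisely that some lattice point of some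
  \<open>dilate m P\<close> has no decomposition; see \<open>lattice_polytope_dilate_cycle_polytope\<close> below.
\<close>

definition normal_in :: "'a::real_vector set \<Rightarrow> 'a set \<Rightarrow> bool" where
  "normal_in M P \<longleftrightarrow>
     (\<forall>m::nat. m > 0 \<longrightarrow> (\<forall>x \<in> dilate m P \<inter> M.
        \<exists>p :: nat \<Rightarrow> 'a. (\<forall>i<m. p i \<in> P \<inter> M) \<and> x = (\<Sum>i<m. p i)))"

lemma edge_vec_cycle_edge_in_lattice:
  assumes "k \<ge> 1" "1 \<le> i" "i \<le> 2 * k" "h \<in> \<int>"
  shows "(edge_vec (cycle_edge k i), h) \<in> cycle_lattice k"
proof -
  have fin: "finite (cycle_edge k i)"
    by (simp add: cycle_edge_def)
  have "Poly_Mapping.keys (edge_vec (cycle_edge k i)) \<subseteq> cycle_edge k i"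
    by (auto simp: in_keys_iff lookup_edge_vec[OF fin] split: if_splits)
  moreover have "cycle_edge k i \<subseteq> {1..2 * k}"
    using assms by (auto simp: cycle_edge_def)
  ultimately show ?thesis
    using assms(4) by (auto simp: cycle_lattice_def lookup_edge_vec[OF fin])
qed

lemma scale_in_cycle_lattice:
  assumes "x \<in> cycle_lattice k"
  shows "real n *\<^sub>R x \<in> cycle_lattice k"
proof -
  have "Poly_Mapping.lookup (real n *\<^sub>R fst x) v = real n * Poly_Mapping.lookup (fst x) v" for v
    by (simp add: scaleR_poly_mapping_def)
  then show ?thesis
    using assms by (auto simp: cycle_lattice_def in_keys_iff)
qed

lemma lattice_polytope_dilate_cycle_polytope:
  assumes "k \<ge> 1"
  shows "lattice_polytope (cycle_lattice k) (dilate n (cycle_polytope k a))"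
proof -
  let ?V = "cycle_polytope_vertices k a"
  have "?V \<subseteq> cycle_lattice k"
    using assms
    by (auto simp: cycle_polytope_vertices_def intro!: edge_vec_cycle_edge_in_lattice)
  then have "(\<lambda>x. real n *\<^sub>R x) ` ?V \<subseteq> cycle_lattice k"
    using scale_in_cycle_lattice by blast
  moreover have "finite ((\<lambda>x. real n *\<^sub>R x) ` ?V)"
    by (simp add: cycle_polytope_vertices_def)
  moreover have "dilate n (cycle_polytope k a) = convex hull ((\<lambda>x. real n *\<^sub>R x) ` ?V)"
    by (simp add: dilate_def cycle_polytope_def convex_hull_scaling)
  ultimately show ?thesis
    unfolding lattice_polytope_def by blast
qed

end

theory Submission
  imports Defs
begin

text \<open>
  A point of \<open>N \<cdot> P\<close>, for \<open>P\<close> the polytope with parameters \<open>k\<close> and \<open>a\<close>, is a pair \<open>(x, h)\<close> where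
  \<open>x\<close> is a nonnegative combination of the edge vectors with weights \<open>\<lambda>\<^sub>i\<close> of total \<open>N\<close>, and
  \<open>a \<lambda>\<^sub>1 \<le> h \<le> a \<lambda>\<^sub>1 + N\<close> (lemma \<open>mem_dilate_cycle_polytope_iff\<close>). As the cycle is even, \<open>x\<close>
  determines \<open>\<lambda>\<close> only up to adding \<open>t\<close> to the weights of the odd edges and subtracting \<open>t\<close> from
  those of the even edges. If \<open>x\<close> is integral, consecutive weights have integral sums, so one
  integral weight makes all of them integral.

  If integral weights can be chosen, \<open>(x, h)\<close> is a sum of \<open>N\<close> vertices of \<open>P\<close>, which can be
  grouped at will (\<open>integral_weights_imp_sum\<close>). Otherwise move \<open>\<lambda>\<close> along the alternating direction
  to the two nearest integral weight vectors. If \<open>h\<close> is in neither of the two corresponding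
  intervals of length \<open>N\<close>, it is strictly between them, so \<open>N \<le> a - 2\<close>; and the even weights
  of the lower vector are positive integers, so \<open>N \<ge> k\<close>. For \<open>a \<le> k + 2\<close> the only
  possibility is \<open>N = k\<close>, which is not a multiple of \<open>n\<close> if \<open>n\<close> does not divide \<open>k\<close>; hence
  \<open>n \<cdot> P\<close> is normal (\<open>normal_in_dilate_cycle_polytope\<close>).

  Conversely, for \<open>a \<ge> k + 2\<close> the point \<open>((1, \<dots>, 1), k + 1)\<close> of \<open>k \<cdot> P\<close> does lie in this gap. If
  \<open>n < k\<close>, a total weight \<open>n\<close> is too small to be positive on the \<open>k\<close> disjoint pairs of edges
  \<open>{2 j - 1, 2 j}\<close>, so every lattice point of \<open>n \<cdot> P\<close> has integral weights only. A sum of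
  \<open>k div n\<close> of them has height in \<open>[a T, a T + k]\<close> for an integer \<open>T\<close>, and \<open>k + 1\<close> is in no such
  interval (\<open>not_normal_in_dilate_cycle_polytope\<close>).
\<close>

section \<open>Edge weights\<close>

definition edge_combination :: "nat \<Rightarrow> (nat \<Rightarrow> real) \<Rightarrow> (nat \<Rightarrow>\<^sub>0 real)" where
  "edge_combination k w = (\<Sum>i=1..2 * k. w i *\<^sub>R edge_vec (cycle_edge k i))"

lemma lookup_scaleR: "Poly_Mapping.lookup (c *\<^sub>R (f :: 'a \<Rightarrow>\<^sub>0 real)) v = c * Poly_Mapping.lookup f v"
  by (simp add: scaleR_poly_mapping_def)

lemma lookup_edge_combination:
  assumes "k \<ge> 1"
  shows "Poly_Mapping.lookup (edge_combination k w) v =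
    (if v \<in> {1..2 * k} then w v + w (if v = 1 then 2 * k else v - 1) else 0)"
proof -
  let ?p = "if v = 1 then 2 * k else v - 1"
  have fin: "finite (cycle_edge k i)" for i
    by (simp add: cycle_edge_def)
  have "Poly_Mapping.lookup (edge_combination k w) v =
      (\<Sum>i=1..2 * k. if v \<in> cycle_edge k i then w i else 0)"
    unfolding edge_combination_def
    by (auto simp: lookup_sum lookup_scaleR lookup_edge_vec[OF fin] intro!: sum.cong)
  also have "\<dots> = (\<Sum>i\<in>{i\<in>{1..2 * k}. v \<in> cycle_edge k i}. w i)"
    by (rule sum.inter_filter[symmetric]) simp
  also have "{i\<in>{1..2 * k}. v \<in> cycle_edge k i} = (if v \<in> {1..2 * k} then {v, ?p} else {})"
    using assms by (auto simp: cycle_edge_def split: if_splits)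
  also have "sum w \<dots> = (if v \<in> {1..2 * k} then w v + w ?p else 0)"
    using assms by auto
  finally show ?thesis .
qed

lemma sum_consecutive_pairs:
  fixes f :: "nat \<Rightarrow> 'a::comm_monoid_add"
  shows "(\<Sum>i=1..2 * k. f i) = (\<Sum>j=1..k. f (2 * j - 1) + f (2 * j))"
  by (induction k) (simp_all add: add.assoc)

lemma edge_combination_eqI:
  assumes "k \<ge> 1"
    and "\<And>v. v \<in> {2..2 * k} \<Longrightarrow> u v + u (v - 1) = w v + w (v - 1)"
    and "u 1 + u (2 * k) = w 1 + w (2 * k)"
  shows "edge_combination k u = edge_combination k w"
proof (rule poly_mapping_eqI)
  fix v
  consider "v = 1" | "v \<in> {2..2 * k}" | "v \<notin> {1..2 * k}" by fastforce
  then show "Poly_Mapping.lookup (edge_combination k u) v =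
      Poly_Mapping.lookup (edge_combination k w) v"
    using assms by cases (auto simp: lookup_edge_combination)
qed

text \<open>
  Integrality propagates along the cycle: the weights of two edges that share a vertex add up to
  the coordinate of that vertex.
\<close>

lemma weight_parity:
  assumes k: "k \<ge> 1"
    and int: "\<And>v. Poly_Mapping.lookup (edge_combination k w) v \<in> \<int>"
    and i: "i \<in> {1..2 * k}"
  shows "(if odd i then w i - w 1 else w i + w 1) \<in> \<int>"
proof -
  have consecutive: "w (Suc i) + w i \<in> \<int>" if "1 \<le> i" "Suc i \<le> 2 * k" for i
    using int[of "Suc i"] that k by (simp add: lookup_edge_combination)
  have "1 \<le> i" "i \<le> 2 * k" using i by auto
  then show ?thesis
  proof (induction i rule: dec_induct)
    case base
    then show ?case by simp
  next
    case (step i)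
    have s: "w (Suc i) + w i \<in> \<int>"
      using step.hyps(1) step.prems by (rule consecutive)
    show ?case
    proof (cases "odd i")
      case True
      then have "w i - w 1 \<in> \<int>" using step by simp
      from Ints_diff[OF s this] show ?thesis using True by (simp add: algebra_simps)
    next
      case False
      then have "w i + w 1 \<in> \<int>" using step by simp
      from Ints_diff[OF s this] show ?thesis using False by (simp add: algebra_simps)
    qed
  qed
qed

section \<open>Points of the dilated polytope\<close>

text \<open>
  Membership in \<open>N \<cdot> P\<close> with explicit witness \<open>w\<close>. The conditions are jointly linear in \<open>N\<close>, \<open>w\<close> and \<open>p\<close>,
  which makes convexity and dilation immediate; for this \<open>N\<close> is a real number.
\<close>

definition height_weights :: "nat \<Rightarrow> nat \<Rightarrow> real \<Rightarrow> (nat \<Rightarrow> real) \<Rightarrow> (nat \<Rightarrow>\<^sub>0 real) \<times> real \<Rightarrow> bool"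
  where "height_weights k a N w p \<longleftrightarrow>
    (\<forall>i\<in>{1..2 * k}. 0 \<le> w i) \<and> (\<Sum>i=1..2 * k. w i) = N \<and> fst p = edge_combination k w \<and>
    real a * w 1 \<le> snd p \<and> snd p \<le> real a * w 1 + N"

lemma height_weights_scale:
  assumes "height_weights k a N w p" "0 \<le> c"
  shows "height_weights k a (c * N) (\<lambda>i. c * w i) (c *\<^sub>R p)"
proof -
  have "c * (real a * w 1) \<le> c * snd p" "c * snd p \<le> c * (real a * w 1 + N)"
    using assms by (auto simp: height_weights_def intro!: mult_left_mono)
  then show ?thesis
    using assms
    by (auto simp: height_weights_def edge_combination_def sum_distrib_left scaleR_sum_right
        algebra_simps)
qed

lemma height_weights_add:
  assumes "height_weights k a M u p" "height_weights k a N w q"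
  shows "height_weights k a (M + N) (\<lambda>i. u i + w i) (p + q)"
  using assms
  by (auto simp: height_weights_def edge_combination_def sum.distrib algebra_simps)

lemma convex_height_weights: "convex {p. \<exists>w. height_weights k a 1 w p}"
proof (rule convexI)
  fix p q :: "(nat \<Rightarrow>\<^sub>0 real) \<times> real" and s t :: real
  assume st: "0 \<le> s" "0 \<le> t" "s + t = 1"
  assume "p \<in> {p. \<exists>w. height_weights k a 1 w p}" "q \<in> {p. \<exists>w. height_weights k a 1 w p}"
  then obtain u w where "height_weights k a 1 u p" "height_weights k a 1 w q" by auto
  from height_weights_add[OF height_weights_scale[OF this(1) st(1)]
      height_weights_scale[OF this(2) st(2)]]
  show "s *\<^sub>R p + t *\<^sub>R q \<in> {p. \<exists>w. height_weights k a 1 w p}"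
    using st by auto
qed

lemma edge_combination_indicator:
  assumes "i \<in> {1..2 * k}"
  shows "edge_combination k (\<lambda>j. if j = i then 1 else 0) = edge_vec (cycle_edge k i)"
proof -
  have "edge_combination k (\<lambda>j. if j = i then 1 else 0) =
      (\<Sum>j=1..2 * k. if j = i then edge_vec (cycle_edge k i) else 0)"
    unfolding edge_combination_def by (rule sum.cong) auto
  then show ?thesis using assms by simp
qed

lemma cycle_polytope_vertices_eq:
  assumes "k \<ge> 1"
  shows "cycle_polytope_vertices k a =
    (\<Union>i\<in>{1..2 * k}. (\<lambda>s. (edge_vec (cycle_edge k i), (if i = 1 then real a else 0) + s)) ` {0, 1})"
    (is "_ = (\<Union>i\<in>_. ?V i)")
proof -
  have "(\<Union>i\<in>{1..2 * k}. ?V i) = (\<Union>i\<in>{2..2 * k}. ?V i) \<union> ?V 1"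
  proof -
    have "{1..2 * k} = insert 1 {2..2 * k}" using assms by auto
    then show ?thesis by (simp only: UN_insert Un_commute)
  qed
  also have "(\<Union>i\<in>{2..2 * k}. ?V i) =
      (\<Union>i\<in>{2..2 * k}. {(edge_vec (cycle_edge k i), 0), (edge_vec (cycle_edge k i), 1)})"
    by (rule SUP_cong) auto
  finally show ?thesis unfolding cycle_polytope_vertices_def by simp
qed

lemma cycle_polytope_imp_weights:
  assumes "k \<ge> 1" "p \<in> cycle_polytope k a"
  shows "\<exists>w. height_weights k a 1 w p"
proof -
  have "cycle_polytope_vertices k a \<subseteq> {p. \<exists>w. height_weights k a 1 w p}"
  proof
    fix p assume "p \<in> cycle_polytope_vertices k a"
    then obtain i s where p: "p = (edge_vec (cycle_edge k i), (if i = 1 then real a else 0) + s)"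
      "i \<in> {1..2 * k}" "s \<in> {0, 1}"
      unfolding cycle_polytope_vertices_eq[OF assms(1)] by blast
    then have "height_weights k a 1 (\<lambda>j. if j = i then 1 else 0) p"
      by (auto simp: height_weights_def edge_combination_indicator)
    then show "p \<in> {p. \<exists>w. height_weights k a 1 w p}" by blast
  qed
  then have "cycle_polytope k a \<subseteq> {p. \<exists>w. height_weights k a 1 w p}"
    unfolding cycle_polytope_def using convex_height_weights by (rule hull_minimal)
  then show ?thesis using assms by blast
qed

lemma edge_point_in_cycle_polytope:
  assumes "k \<ge> 1" "i \<in> {1..2 * k}" "0 \<le> s" "s \<le> 1"
  shows "(edge_vec (cycle_edge k i), (if i = 1 then real a else 0) + s) \<in> cycle_polytope k a"
proof -
  let ?v = "\<lambda>s. (edge_vec (cycle_edge k i), (if i = 1 then real a else 0) + s)"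
  have "?v b \<in> cycle_polytope k a" if "b \<in> {0, 1}" for b
    unfolding cycle_polytope_def cycle_polytope_vertices_eq[OF assms(1)]
    by (rule hull_inc, rule UN_I[OF assms(2)], rule imageI[OF that])
  from this[of 0] this[of 1] have "(1 - s) *\<^sub>R ?v 0 + s *\<^sub>R ?v 1 \<in> cycle_polytope k a"
    using assms(3,4) unfolding cycle_polytope_def
    by (intro convexD[OF convex_convex_hull]) simp_all
  also have "(1 - s) *\<^sub>R ?v 0 + s *\<^sub>R ?v 1 = ?v s"
    by (auto simp: algebra_simps)
  finally show ?thesis .
qed

text \<open>
  Raise every edge point above its lowest position by the same amount, the distance of \<open>p\<close> from the
  lower end of its height interval; the given weights then combine these points to \<open>p\<close>.
\<close>

lemma weights_imp_cycle_polytope: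
  assumes "k \<ge> 1" "height_weights k a 1 w p"
  shows "p \<in> cycle_polytope k a"
proof -
  let ?y = "\<lambda>i. (edge_vec (cycle_edge k i),
    (if i = 1 then real a else 0) + (snd p - real a * w 1))"
  have w: "\<And>i. i \<in> {1..2 * k} \<Longrightarrow> 0 \<le> w i" "(\<Sum>i=1..2 * k. w i) = 1"
    using assms by (auto simp: height_weights_def)
  have "(\<Sum>i=1..2 * k. w i *\<^sub>R ?y i) \<in> cycle_polytope k a"
  proof (rule convex_sum)
    show "?y i \<in> cycle_polytope k a" if "i \<in> {1..2 * k}" for i
      using assms that
      by (intro edge_point_in_cycle_polytope) (auto simp: height_weights_def)
  qed (use w in \<open>auto simp: cycle_polytope_def\<close>)
  moreover have "(\<Sum>i=1..2 * k. w i *\<^sub>R ?y i) = p"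
  proof (rule prod_eqI)
    show "fst (\<Sum>i=1..2 * k. w i *\<^sub>R ?y i) = fst p"
      using assms by (simp add: fst_sum height_weights_def edge_combination_def)
    have "snd (\<Sum>i=1..2 * k. w i *\<^sub>R ?y i) =
        (\<Sum>i=1..2 * k. (if i = 1 then w 1 * real a else 0) + w i * (snd p - real a * w 1))"
      by (auto simp: snd_sum algebra_simps intro!: sum.cong)
    also have "\<dots> = w 1 * real a + (\<Sum>i=1..2 * k. w i) * (snd p - real a * w 1)"
      using assms by (simp add: sum.distrib sum_distrib_right)
    finally show "snd (\<Sum>i=1..2 * k. w i *\<^sub>R ?y i) = snd p"
      using w by simp
  qed
  ultimately show ?thesis by simp
qed

lemma mem_dilate_cycle_polytope_iff:
  assumes "k \<ge> 1" "n > 0"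
  shows "p \<in> dilate n (cycle_polytope k a) \<longleftrightarrow> (\<exists>w. height_weights k a (real n) w p)"
proof
  assume "p \<in> dilate n (cycle_polytope k a)"
  then obtain q where q: "q \<in> cycle_polytope k a" "p = real n *\<^sub>R q"
    by (auto simp: dilate_def)
  then obtain w where "height_weights k a 1 w q"
    using cycle_polytope_imp_weights assms by blast
  from height_weights_scale[OF this, of "real n"]
  show "\<exists>w. height_weights k a (real n) w p" using q by auto
next
  assume "\<exists>w. height_weights k a (real n) w p"
  then obtain w where "height_weights k a (real n) w p" ..
  from height_weights_scale[OF this, of "1 / real n"]
  have "height_weights k a 1 (\<lambda>i. w i / real n) ((1 / real n) *\<^sub>R p)" using assms by simp
  then have "(1 / real n) *\<^sub>R p \<in> cycle_polytope k a"
    using weights_imp_cycle_polytope assms by blast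
  moreover have "p = real n *\<^sub>R ((1 / real n) *\<^sub>R p)" using assms by simp
  ultimately show "p \<in> dilate n (cycle_polytope k a)"
    unfolding dilate_def by blast
qed

lemma dilate_dilate: "dilate m (dilate n P) = dilate (m * n) P"
  by (simp add: dilate_def image_image)

section \<open>Decomposition into lattice points\<close>

lemma cycle_lattice_add:
  assumes "p \<in> cycle_lattice k" "q \<in> cycle_lattice k"
  shows "p + q \<in> cycle_lattice k"
  using assms keys_add[of "fst p" "fst q"] by (auto simp: cycle_lattice_def lookup_add)

lemma cycle_lattice_sum:
  assumes "\<And>j. j \<in> J \<Longrightarrow> p j \<in> cycle_lattice k"
  shows "sum p J \<in> cycle_lattice k"
proof -
  have "0 \<in> cycle_lattice k" by (simp add: cycle_lattice_def)
  then show ?thesis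
    using assms by (induction J rule: infinite_finite_induct) (auto intro: cycle_lattice_add)
qed

lemma weighted_sum_as_sequence:
  fixes f :: "'a \<Rightarrow> 'b::real_vector"
  assumes "finite I" "(\<Sum>i\<in>I. c i) = (N::nat)"
  shows "\<exists>g. (\<forall>j<N. g j \<in> I) \<and> (\<Sum>j<N. f (g j)) = (\<Sum>i\<in>I. real (c i) *\<^sub>R f i)"
  using assms(2)
proof (induction N arbitrary: c)
  case 0
  then show ?case using assms(1) by simp
next
  case (Suc N)
  then obtain i where i: "i \<in> I" "c i > 0"
    by (metis bot_nat_0.not_eq_extremum nat.distinct(1) sum.neutral)
  define d where "d = c(i := c i - 1)"
  have cd: "c j = d j + (if j = i then 1 else 0)" for j
    using i by (auto simp: d_def)
  have "(\<Sum>i\<in>I. c i) = (\<Sum>i\<in>I. d i) + 1"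
    using i assms(1) by (simp add: cd sum.distrib)
  then have "(\<Sum>i\<in>I. d i) = N" using Suc.prems by simp
  from Suc.IH[OF this] obtain g where g: "\<forall>j<N. g j \<in> I"
    "(\<Sum>j<N. f (g j)) = (\<Sum>i\<in>I. real (d i) *\<^sub>R f i)" by blast
  have "(\<Sum>j\<in>I. real (c j) *\<^sub>R f j) =
      (\<Sum>j\<in>I. real (d j) *\<^sub>R f j + (if j = i then f i else 0))"
    by (rule sum.cong) (auto simp: cd algebra_simps)
  also have "\<dots> = (\<Sum>j<N. f (g j)) + f i"
    using i assms(1) g by (simp add: sum.distrib)
  finally have "(\<Sum>j<Suc N. f ((g(N := i)) j)) = (\<Sum>j\<in>I. real (c j) *\<^sub>R f j)"
    by simp
  then show ?case using g(1) i(1)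
    by (intro exI[of _ "g(N := i)"]) (auto simp: less_Suc_eq)
qed

text \<open>
  With integral weights the point is a sum of \<open>m * n\<close> vertices: list the edges with their
  multiplicities, and raise as many of the summands by \<open>1\<close> as the height requires.
\<close>

lemma integral_weights_imp_sum:
  assumes k: "k \<ge> 1" and n: "n > 0"
    and w: "height_weights k a (real (m * n)) w p"
    and int: "\<And>i. i \<in> {1..2 * k} \<Longrightarrow> w i \<in> \<int>" and h: "snd p \<in> \<int>"
  shows "\<exists>q. (\<forall>i<m. q i \<in> dilate n (cycle_polytope k a) \<inter> cycle_lattice k) \<and> p = (\<Sum>i<m. q i)"
proof -
  define c where "c i = nat \<lfloor>w i\<rfloor>" for i
  have c: "w i = real (c i)" if "i \<in> {1..2 * k}" for i
    using int[OF that] w that by (auto simp: c_def height_weights_def elim!: Ints_cases)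
  have "real (\<Sum>i=1..2 * k. c i) = real (m * n)"
    using w c by (simp add: height_weights_def)
  then have csum: "(\<Sum>i=1..2 * k. c i) = m * n" by linarith
  let ?f = "\<lambda>i. (edge_vec (cycle_edge k i), if i = 1 then real a else 0)"
  from weighted_sum_as_sequence[OF _ csum, of ?f]
  obtain g where g: "\<forall>j<m * n. g j \<in> {1..2 * k}"
    "(\<Sum>j<m * n. ?f (g j)) = (\<Sum>i=1..2 * k. real (c i) *\<^sub>R ?f i)" by blast
  have "snd p - real a * w 1 \<in> \<int>"
    using h int[of 1] k by auto
  then obtain z where z: "snd p - real a * w 1 = of_int z" by (auto elim: Ints_cases)
  define d where "d = nat z"
  have d: "snd p = real a * w 1 + real d" "d \<le> m * n"
  proof -
    have "0 \<le> real_of_int z" "real_of_int z \<le> real (m * n)"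
      unfolding z[symmetric] using w by (auto simp: height_weights_def)
    then have z': "0 \<le> z" "z \<le> int (m * n)" by (simp, linarith)
    show "snd p = real a * w 1 + real d" using z z'(1) by (simp add: d_def)
    show "d \<le> m * n" using z'(2) by (simp only: d_def nat_le_iff)
  qed
  define s where "s j = (if j < d then 1 else 0 :: real)" for j
  have ssum: "(\<Sum>j<m * n. s j) = real d"
  proof -
    have "(\<Sum>j<m * n. s j) = (\<Sum>j\<in>{j\<in>{..<m * n}. j < d}. 1)"
      unfolding s_def by (rule sum.inter_filter[symmetric]) simp
    also have "{j\<in>{..<m * n}. j < d} = {..<d}" using d by auto
    finally show ?thesis by simp
  qed
  define v where "v j = ?f (g j) + (0, s j)" for j
  have v_lattice: "v j \<in> cycle_lattice k" if "j < m * n" for j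
    using g(1) that k by (auto simp: v_def s_def intro!: edge_vec_cycle_edge_in_lattice)
  have v_poly: "v j \<in> cycle_polytope k a" if "j < m * n" for j
    using g(1) that k edge_point_in_cycle_polytope[of k "g j" "s j" a]
    by (auto simp: v_def s_def)
  define q where "q i = (\<Sum>j=i * n..<i * n + n. v j)" for i
  have range: "j < m * n" if "i < m" "j \<in> {i * n..<i * n + n}" for i j
  proof -
    have "(i + 1) * n \<le> m * n" using that by (intro mult_right_mono) auto
    then show ?thesis using that by auto
  qed
  have "q i \<in> dilate n (cycle_polytope k a)" if "i < m" for i
  proof -
    have "(\<Sum>j=i * n..<i * n + n. (1 / real n) *\<^sub>R v j) \<in> cycle_polytope k a"
      using v_poly range[OF that] n
      by (intro convex_sum) (auto simp: cycle_polytope_def)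
    moreover have "q i = real n *\<^sub>R (\<Sum>j=i * n..<i * n + n. (1 / real n) *\<^sub>R v j)"
      using n by (simp add: q_def scaleR_sum_right[symmetric])
    ultimately show ?thesis unfolding dilate_def by blast
  qed
  moreover have "q i \<in> cycle_lattice k" if "i < m" for i
    unfolding q_def using v_lattice range[OF that] by (intro cycle_lattice_sum) auto
  moreover have "p = (\<Sum>i<m. q i)"
  proof -
    have "(\<Sum>i<m. q i) = (\<Sum>j<m * n. v j)"
      unfolding q_def by (rule sum.nat_group)
    also have "\<dots> = (\<Sum>i=1..2 * k. w i *\<^sub>R ?f i) + (\<Sum>j<m * n. (0, s j))"
      unfolding v_def sum.distrib g(2) using c by (intro arg_cong2[where f="(+)"] sum.cong) auto
    also have "\<dots> = p"
    proof (rule prod_eqI)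
      show "fst ((\<Sum>i=1..2 * k. w i *\<^sub>R ?f i) + (\<Sum>j<m * n. (0, s j))) = fst p"
        using w by (simp add: fst_sum height_weights_def edge_combination_def)
      have "(\<Sum>i=1..2 * k. w i * (if i = 1 then real a else 0)) =
          (\<Sum>i=1..2 * k. if i = 1 then w 1 * real a else 0)"
        by (rule sum.cong) auto
      also have "\<dots> = w 1 * real a" using k by simp
      finally show "snd ((\<Sum>i=1..2 * k. w i *\<^sub>R ?f i) + (\<Sum>j<m * n. (0, s j))) = snd p"
        using d by (simp add: snd_sum ssum)
    qed
    finally show ?thesis by simp
  qed
  ultimately show ?thesis by blast
qed

section \<open>Normality\<close>

text \<open>
  Moving along the alternating direction until the first weight is integral makes all weights
  integral, and by less than \<open>1\<close>, so that none of them drops to \<open>-1\<close>.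
\<close>

lemma alternating_shift_integral:
  assumes k: "k \<ge> 1"
    and nonneg: "\<forall>i\<in>{1..2 * k}. 0 \<le> w i"
    and int: "\<And>v. Poly_Mapping.lookup (edge_combination k w) v \<in> \<int>"
    and t: "\<bar>t\<bar> < 1" "w 1 + t \<in> \<int>"
  defines "u \<equiv> \<lambda>i. if odd i then w i + t else w i - t"
  shows "\<And>i. i \<in> {1..2 * k} \<Longrightarrow> u i \<in> \<int> \<and> 0 \<le> u i"
    and "(\<Sum>i=1..2 * k. u i) = (\<Sum>i=1..2 * k. w i)"
    and "edge_combination k u = edge_combination k w"
proof -
  fix i assume i: "i \<in> {1..2 * k}"
  have "u i \<in> \<int>"
  proof (cases "odd i")
    case True
    with weight_parity[OF k int i] have "w i - w 1 \<in> \<int>" by simp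
    from Ints_add[OF this t(2)] True show ?thesis by (simp add: u_def)
  next
    case False
    with weight_parity[OF k int i] have "w i + w 1 \<in> \<int>" by simp
    from Ints_diff[OF this t(2)] False show ?thesis by (simp add: u_def)
  qed
  moreover have "-1 < u i"
    using nonneg i t by (force simp: u_def abs_less_iff)
  ultimately show "u i \<in> \<int> \<and> 0 \<le> u i"
    by (auto elim!: Ints_cases)
next
  show "(\<Sum>i=1..2 * k. u i) = (\<Sum>i=1..2 * k. w i)"
    unfolding sum_consecutive_pairs by (rule sum.cong) (auto simp: u_def)
next
  show "edge_combination k u = edge_combination k w"
    using k by (intro edge_combination_eqI) (auto simp: u_def)
qed

theorem normal_in_dilate_cycle_polytope:
  assumes k: "k \<ge> 1" and a: "a \<le> k + 2" and n: "n > 0" "\<not> n dvd k"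
  shows "normal_in (cycle_lattice k) (dilate n (cycle_polytope k a))"
  unfolding normal_in_def
proof (intro allI impI ballI)
  fix m :: nat and p
  assume m: "m > 0"
    and p: "p \<in> dilate m (dilate n (cycle_polytope k a)) \<inter> cycle_lattice k"
  define N where "N = m * n"
  have "N > 0" using m n by (simp add: N_def)
  obtain w where w: "height_weights k a (real N) w p"
    using p mem_dilate_cycle_polytope_iff[OF k \<open>N > 0\<close>] by (auto simp: dilate_dilate N_def)
  have nonneg: "\<forall>i\<in>{1..2 * k}. 0 \<le> w i" using w by (simp add: height_weights_def)
  have int: "Poly_Mapping.lookup (edge_combination k w) v \<in> \<int>" for v
    using w p by (auto simp: height_weights_def cycle_lattice_def)
  have h: "snd p \<in> \<int>" using p by (simp add: cycle_lattice_def)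
  define u where "u t = (\<lambda>i. if odd i then w i + t else w i - t)" for t
  note shift = alternating_shift_integral[OF k nonneg int, folded u_def]
  have u_nat: "u t i \<in> \<int>" "0 \<le> u t i"
    if "\<bar>t\<bar> < 1" "w 1 + t \<in> \<int>" "i \<in> {1..2 * k}" for t i
    using shift(1)[OF that] by (simp_all add: u_def)
  let ?decomposable =
    "\<exists>q. (\<forall>i<m. q i \<in> dilate n (cycle_polytope k a) \<inter> cycle_lattice k) \<and> p = (\<Sum>i<m. q i)"
  have in_interval: ?decomposable if t: "\<bar>t\<bar> < 1" "w 1 + t \<in> \<int>"
      and "real a * (w 1 + t) \<le> snd p" "snd p \<le> real a * (w 1 + t) + real N" for t
  proof (rule integral_weights_imp_sum[OF k n(1) _ _ h])
    show "height_weights k a (real (m * n)) (u t) p"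
      using shift[OF t] that w unfolding height_weights_def N_def by (simp add: u_def)
    show "u t i \<in> \<int>" if "i \<in> {1..2 * k}" for i
      using u_nat(1)[OF t that] .
  qed
  show ?decomposable
  proof (rule ccontr)
    assume contra: "\<not> ?decomposable"
    \<comment> \<open>The shifts by \<open>- f\<close> and by \<open>1 - f\<close> lead to the two nearest integral weight vectors.\<close>
    define f where "f = frac (w 1)"
    have f: "0 \<le> f" "f < 1" and floor: "w 1 - f = of_int \<lfloor>w 1\<rfloor>"
      by (simp_all add: f_def frac_lt_1) (simp add: frac_def)
    have ht: "real a * w 1 \<le> snd p" "snd p \<le> real a * w 1 + real N"
      using w by (auto simp: height_weights_def)
    have int_down: "w 1 + (- f) \<in> \<int>" and int_up: "w 1 + (1 - f) \<in> \<int>"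
    proof -
      show "w 1 + (- f) \<in> \<int>" using floor by simp
      from Ints_add[OF this Ints_1] show "w 1 + (1 - f) \<in> \<int>" by (simp add: algebra_simps)
    qed
    have "real a * (w 1 + (- f)) \<le> real a * w 1"
      using f by (intro mult_left_mono) auto
    with ht have "real a * (w 1 + (- f)) \<le> snd p" by linarith
    with in_interval[of "- f"] contra f int_down
    have above: "real a * (w 1 + (- f)) + real N < snd p" by force
    have "f \<noteq> 0" using above ht by auto
    with f have fpos: "0 < f" by simp
    have "real a * w 1 \<le> real a * (w 1 + (1 - f))"
      using f by (intro mult_left_mono) auto
    with ht have "snd p \<le> real a * (w 1 + (1 - f)) + real N" by linarith
    with in_interval[of "1 - f"] contra f fpos int_up
    have below: "snd p < real a * (w 1 + (1 - f))" by force
    obtain z where z: "snd p = of_int z" using h by (auto elim: Ints_cases)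
    have "of_int (int a * \<lfloor>w 1\<rfloor> + int N) < (of_int z :: real)"
      using above floor z by simp
    then have above': "int a * \<lfloor>w 1\<rfloor> + int N < z" by linarith
    have up: "w 1 + (1 - f) = of_int (\<lfloor>w 1\<rfloor> + 1)" using floor by simp
    have "(of_int z :: real) < of_int (int a * (\<lfloor>w 1\<rfloor> + 1))"
      using below unfolding z up by simp
    then have "z < int a * (\<lfloor>w 1\<rfloor> + 1)" by linarith
    with above' have "int N + 2 \<le> int a" by (simp add: algebra_simps)
    with a have "N \<le> k" by linarith
    have down: "\<bar>- f\<bar> < 1" using f by simp
    have pair: "1 \<le> u (- f) (2 * j - 1) + u (- f) (2 * j)" if j: "j \<in> {1..k}" for j
    proof -
      have "2 * j - 1 \<in> {1..2 * k}" "2 * j \<in> {1..2 * k}" using j by auto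
      with u_nat[OF down int_down] nonneg
      have "0 \<le> u (- f) (2 * j - 1)" "u (- f) (2 * j) \<in> \<int>" "0 \<le> w (2 * j)" by blast+
      moreover have "0 < u (- f) (2 * j)" using \<open>0 \<le> w (2 * j)\<close> fpos by (simp add: u_def)
      ultimately have "1 \<le> u (- f) (2 * j)" by (auto elim!: Ints_cases)
      with \<open>0 \<le> u (- f) (2 * j - 1)\<close> show ?thesis by linarith
    qed
    have "real k = (\<Sum>j=1..k. 1)" by simp
    also have "\<dots> \<le> (\<Sum>j=1..k. u (- f) (2 * j - 1) + u (- f) (2 * j))"
      using pair by (rule sum_mono)
    also have "\<dots> = real N"
      using shift(2)[OF down int_down] w
      unfolding sum_consecutive_pairs[symmetric] by (simp add: height_weights_def)
    finally have "k \<le> N" by simp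
    with \<open>N \<le> k\<close> have "k = m * n" by (simp add: N_def)
    with n(2) show False by simp
  qed
qed

section \<open>Failure of normality\<close>

text \<open>
  A total weight below \<open>k\<close> leaves a vertex \<open>2 * j\<close> with coordinate below \<open>1\<close>, hence \<open>0\<close>; both
  edges at this vertex then have weight \<open>0\<close>.
\<close>

lemma small_dilate_first_weight_integral:
  assumes k: "k \<ge> 1" and w: "height_weights k a (real n) w p" and "n < k"
    and p: "p \<in> cycle_lattice k"
  shows "w 1 \<in> \<int>"
proof -
  have nonneg: "\<And>i. i \<in> {1..2 * k} \<Longrightarrow> 0 \<le> w i" using w by (simp add: height_weights_def)
  have int: "Poly_Mapping.lookup (edge_combination k w) v \<in> \<int>" for v
    using w p by (auto simp: height_weights_def cycle_lattice_def)
  obtain j where j: "j \<in> {1..k}" "w (2 * j - 1) + w (2 * j) < 1"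
  proof (rule ccontr)
    assume "\<not> thesis"
    then have "1 \<le> w (2 * j - 1) + w (2 * j)" if "j \<in> {1..k}" for j
      using that \<open>\<And>j. j \<in> {1..k} \<Longrightarrow> w (2 * j - 1) + w (2 * j) < 1 \<Longrightarrow> thesis\<close> by force
    then have "(\<Sum>j=1..k. 1) \<le> (\<Sum>j=1..k. w (2 * j - 1) + w (2 * j))" by (rule sum_mono)
    also have "\<dots> = real n"
      using w unfolding sum_consecutive_pairs[symmetric] by (simp add: height_weights_def)
    finally show False using \<open>n < k\<close> by simp
  qed
  have range: "2 * j - 1 \<in> {1..2 * k}" "2 * j \<in> {1..2 * k}" using j by auto
  have "w (2 * j) + w (2 * j - 1) \<in> \<int>"
    using int[of "2 * j"] range k by (auto simp: lookup_edge_combination split: if_splits)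
  moreover have "0 \<le> w (2 * j)" "0 \<le> w (2 * j - 1)" using nonneg range by blast+
  ultimately have "w (2 * j) + w (2 * j - 1) = 0" using j(2) by (auto elim!: Ints_cases)
  with \<open>0 \<le> w (2 * j)\<close> \<open>0 \<le> w (2 * j - 1)\<close> have "w (2 * j) = 0" by linarith
  then show ?thesis using weight_parity[OF k int range(2)] by simp
qed

theorem not_normal_in_dilate_cycle_polytope:
  assumes n: "n dvd k" "0 < n" "n < k" and a: "k + 2 \<le> a"
  shows "\<not> normal_in (cycle_lattice k) (dilate n (cycle_polytope k a))"
proof
  assume normal: "normal_in (cycle_lattice k) (dilate n (cycle_polytope k a))"
  have k: "k \<ge> 1" using n by simp
  obtain m where m: "k = m * n" using n(1) by (metis dvd_div_mult_self)
  have "m > 0" using m k by (cases m) auto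
  \<comment> \<open>This weight of the first edge puts the height \<open>k + 1\<close> at the lower end of its interval.\<close>
  define s where "s = real (k + 1) / real a"
  have s: "0 \<le> s" "s \<le> 1" "real a * s = real (k + 1)"
    using a by (auto simp: s_def field_simps)
  define w where "w i = (if odd i then s else 1 - s)" for i :: nat
  define p where "p = (edge_combination k w, real (k + 1))"
  have "(\<Sum>i=1..2 * k. w i) = (\<Sum>j=1..k. 1)"
    unfolding sum_consecutive_pairs by (rule sum.cong) (auto simp: w_def)
  then have "height_weights k a (real k) w p"
    using s unfolding height_weights_def by (auto simp: p_def w_def)
  then have "p \<in> dilate m (dilate n (cycle_polytope k a))"
    using mem_dilate_cycle_polytope_iff k m by (auto simp: dilate_dilate)
  moreover have "p \<in> cycle_lattice k"
    using k by (auto simp: p_def cycle_lattice_def in_keys_iff lookup_edge_combination w_def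
        split: if_splits)
  ultimately obtain q where
    q: "\<And>i. i < m \<Longrightarrow> q i \<in> dilate n (cycle_polytope k a) \<inter> cycle_lattice k"
      "p = (\<Sum>i<m. q i)"
    using normal \<open>m > 0\<close> unfolding normal_in_def by blast
  have "\<forall>i. \<exists>w. i < m \<longrightarrow> height_weights k a (real n) w (q i)"
    using q(1) mem_dilate_cycle_polytope_iff[OF k n(2)] by blast
  then obtain W where W: "\<And>i. i < m \<Longrightarrow> height_weights k a (real n) (W i) (q i)" by metis
  define T where "T = (\<Sum>i<m. W i 1)"
  have "T \<in> \<int>"
    unfolding T_def
    using small_dilate_first_weight_integral[OF k W n(3)] q(1) by (intro Ints_sum) auto
  then obtain z where z: "T = of_int z" by (auto elim: Ints_cases)
  have "real (k + 1) = (\<Sum>i<m. snd (q i))"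
    using q(2) by (simp add: p_def snd_sum[symmetric]) (metis snd_conv)
  moreover have "real a * T \<le> (\<Sum>i<m. snd (q i))"
    unfolding T_def sum_distrib_left
    using W by (intro sum_mono) (auto simp: height_weights_def)
  moreover have "(\<Sum>i<m. snd (q i)) \<le> (\<Sum>i<m. real a * W i 1 + real n)"
    using W by (intro sum_mono) (auto simp: height_weights_def)
  moreover have "\<dots> = real a * T + real k"
    by (simp add: T_def sum.distrib sum_distrib_left m)
  ultimately have "of_int (int a * z) \<le> real_of_int (int (k + 1))"
    "real_of_int (int (k + 1)) \<le> of_int (int a * z + int k)"
    by (simp_all add: z)
  then have az: "int a * z \<le> int (k + 1)" "int (k + 1) \<le> int a * z + int k"
    by linarith+
  show False
  proof (cases "z \<le> 0")
    case True
    then have "int a * z \<le> 0" by (simp add: mult_nonneg_nonpos)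
    with az(2) show ?thesis by simp
  next
    case False
    then have "int a * 1 \<le> int a * z" by (intro mult_left_mono) auto
    with az(1) a show ?thesis by simp
  qed
qed

section \<open>Sums of normal dilates\<close>

theorem mainTheorem8:
  shows "(\<forall>k n1 n2 :: nat.
            k \<ge> 2 \<and> n1 > 0 \<and> n2 > 0 \<and> \<not> n1 dvd k \<and> \<not> n2 dvd k \<and>
            (n1 + n2) dvd k \<and> n1 + n2 < k \<longrightarrow>
              normal_in (cycle_lattice k) (dilate n1 (cycle_polytope k (k + 2))) \<and>
              normal_in (cycle_lattice k) (dilate n2 (cycle_polytope k (k + 2))) \<and>
              \<not> normal_in (cycle_lattice k) (dilate (n1 + n2) (cycle_polytope k (k + 2)))) \<and>
         normal_in (cycle_lattice 25) (dilate 2 (cycle_polytope 25 27)) \<and>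
         normal_in (cycle_lattice 25) (dilate 3 (cycle_polytope 25 27)) \<and>
         \<not> normal_in (cycle_lattice 25) (dilate 5 (cycle_polytope 25 27))"
proof (intro conjI allI impI; (elim conjE)?)
  show "normal_in (cycle_lattice 25) (dilate 2 (cycle_polytope 25 27))"
    and "normal_in (cycle_lattice 25) (dilate 3 (cycle_polytope 25 27))"
    by (rule normal_in_dilate_cycle_polytope; simp)+
  show "\<not> normal_in (cycle_lattice 25) (dilate 5 (cycle_polytope 25 27))"
    by (rule not_normal_in_dilate_cycle_polytope) simp_all
qed (simp_all add: normal_in_dilate_cycle_polytope not_normal_in_dilate_cycle_polytope)

end
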